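(* Let $(\mu^\star_t)_{t\in[0,1]}$, $\mu^\star_t=\mathcal N(0,\Sigma_t)$, be a curve of centered non-degenerate Gaussians on $\mathbb{R}^d$ with Lagrangian coupling $(X^\star_t)$, and let $L:=\sup_{t\in[0,1]}\|\dot X^\star_t\|_{L^2(\mathbb P)}$. Let $t,t+h\in[0,1]$ with $h\neq0$, write $\delta:=|h|$, and assume $\delta\le c\sqrt{\lambda_{\min}(\Sigma_t)}/L$ for some constant $0<c<1$. Let $T$ be the Monge map from $\mu^\star_t$ to $\mu^\star_{t+h}$, and let $\bar T:\mathbb{R}^d\to\mathbb{R}^d$ be a linear map given by a symmetric matrix and satisfying $\|\bar TX^\star_t-X^\star_t\|_{L^2(\mathbb P)}\le c\sqrt{\lambda_{\min}(\Sigma_t)}$. Then $$\|TX^\star_t-\bar TX^\star_t\|_{L^2(\mathbb P)}\le\frac{1+2c}{1-c}\,\|\bar TX^\star_t-X^\star_{t+h}\|_{L^2(\mathbb P)}.$$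
   Context: $\lambda_{\min}(\Sigma)$ is the smallest eigenvalue of $\Sigma$; $\|Z\|_{L^2(\mathbb P)}=\sqrt{\mathbb E\|Z\|^2}$. The Monge map from $\mathcal N(0,\Sigma_1)$ to $\mathcal N(0,\Sigma_2)$ is the linear map with symmetric matrix $\Sigma_1^{-1/2}(\Sigma_1^{1/2}\Sigma_2\Sigma_1^{1/2})^{1/2}\Sigma_1^{-1/2}$. The curve $t\mapsto\Sigma_t$ is assumed regular; its tangent velocity fields are $x\mapsto V_tx$ with $V_t$ symmetric, and the Lagrangian coupling is the process with $X^\star_0\sim\mu^\star_0$, $\dot X^\star_t=V_tX^\star_t$, so $X^\star_t\sim\mu^\star_t$. *)

theory Defs
  imports "HOL-Probability.Probability"
begin

definition sym_mat :: "real^'n^'n \<Rightarrow> bool" where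
  "sym_mat A \<longleftrightarrow> transpose A = A"

definition psd_mat :: "real^'n^'n \<Rightarrow> bool" where
  "psd_mat A \<longleftrightarrow> sym_mat A \<and> (\<forall>x. 0 \<le> x \<bullet> (A *v x))"

definition pd_mat :: "real^'n^'n \<Rightarrow> bool" where
  "pd_mat A \<longleftrightarrow> sym_mat A \<and> (\<forall>x. x \<noteq> 0 \<longrightarrow> 0 < x \<bullet> (A *v x))"

definition msqrt :: "real^'n^'n \<Rightarrow> real^'n^'n" where
  "msqrt A = (THE S. psd_mat S \<and> S ** S = A)"

definition lambda_min :: "real^'n^'n \<Rightarrow> real" where
  "lambda_min A = Inf {l. \<exists>v. v \<noteq> 0 \<and> A *v v = l *\<^sub>R v}"

definition std_gauss :: "(real^'n) measure" where
  "std_gauss = density lborel (\<lambda>x. ennreal (\<Prod>i\<in>UNIV. std_normal_density (x $ i)))"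

definition gaussian :: "real^'n^'n \<Rightarrow> (real^'n) measure" where
  "gaussian S = distr std_gauss borel (\<lambda>x. msqrt S *v x)"

text \<open>Matrix of the Monge map from N(0,S1) to N(0,S2).\<close>
definition monge_mat :: "real^'n^'n \<Rightarrow> real^'n^'n \<Rightarrow> real^'n^'n" where
  "monge_mat S1 S2 = matrix_inv (msqrt S1) ** msqrt (msqrt S1 ** S2 ** msqrt S1) ** matrix_inv (msqrt S1)"

definition L2norm :: "'a measure \<Rightarrow> ('a \<Rightarrow> real^'n) \<Rightarrow> real" where
  "L2norm P Z = sqrt (integral\<^sup>L P (\<lambda>\<omega>. (norm (Z \<omega>))\<^sup>2))"

end

theory Submission
  imports Defs
begin

text \<open>Write \<open>B\<close> for the matrix of the approximate map, \<open>X = X\<^sub>t\<close>,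
  \<open>Y = X\<^sub>t\<^sub>+\<^sub>h\<close>, and consider the duality gap of the quadratic potential with Hessian \<open>B\<close>,
  \<open>gap x y = (Bx - y) \<bullet> B\<^sup>-\<^sup>1 (Bx - y) = x \<bullet> Bx - 2 x \<bullet> y + y \<bullet> B\<^sup>-\<^sup>1 y\<close>.
  Since \<open>TX\<close> and \<open>Y\<close> have the same law and \<open>T\<close> maximises the correlation with \<open>X\<close>, the mean gap of
  \<open>(X, TX)\<close> is at most that of \<open>(X, Y)\<close>. The closeness assumption on \<open>B\<close> forces \<open>\<parallel>B - I\<parallel> \<le> c\<close>, so the gap is
  comparable to \<open>\<parallel>Bx - y\<parallel>\<^sup>2\<close> with factors \<open>1 / (1 + c)\<close> and \<open>1 / (1 - c)\<close>. This yields the constant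
  \<open>sqrt ((1 + c) / (1 - c))\<close>, which is smaller than the one claimed.
  Gaussianity enters only through second moments.\<close>

section \<open>Symmetric matrices\<close>

lemma sym_mat_inner:
  fixes A :: "real^'n^'n"
  assumes "sym_mat A"
  shows "(A *v x) \<bullet> y = x \<bullet> (A *v y)"
  by (metis assms dot_lmul_matrix sym_mat_def vector_transpose_matrix)

lemma sym_matI:
  fixes A :: "real^'n^'n"
  assumes "\<And>x y. (A *v x) \<bullet> y = x \<bullet> (A *v y)"
  shows "sym_mat A"
proof -
  have "transpose A *v y = A *v y" for y
    by (rule vector_eq_ldot[THEN iffD1])
       (metis assms dot_lmul_matrix transpose_matrix_vector inner_commute)
  then show ?thesis
    unfolding sym_mat_def by (simp add: matrix_eq)
qed

section \<open>Rayleigh quotients and the spectral theorem\<close>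

lemma quadratic_nonneg_imp_linear_coeff_zero:
  fixes a b :: real
  assumes "\<And>e. 0 \<le> 2 * e * a + e\<^sup>2 * b" "0 \<le> a"
  shows "a = 0"
proof (rule ccontr)
  assume "a \<noteq> 0"
  then have a: "0 < a" using assms(2) by simp
  \<comment> \<open>A negative \<open>e\<close> so small that \<open>\<bar>e * b\<bar> < a\<close>:
    the linear term then dominates and the quadratic expression becomes negative. The summand 1
    keeps the denominator positive when \<open>b = 0\<close>.\<close>
  define e where "e = - a / (\<bar>b\<bar> + 1)"
  have "e * (2 * a + e * b) = 2 * e * a + e\<^sup>2 * b"
    by (simp add: algebra_simps power2_eq_square)
  moreover have "e < 0" unfolding e_def using a by (simp add: divide_neg_pos)
  moreover have "0 < 2 * a + e * b"
  proof -
    have "a * b \<le> a * \<bar>b\<bar>" using a by (intro mult_left_mono) auto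
    also have "\<dots> < 2 * a * (\<bar>b\<bar> + 1)"
      using a mult_nonneg_nonneg[of a "\<bar>b\<bar>"] by (simp only: distrib_left mult.assoc) linarith
    finally have "a * b / (\<bar>b\<bar> + 1) < 2 * a" by (simp add: divide_less_eq)
    then show ?thesis by (simp add: e_def)
  qed
  ultimately show False
    using assms(1)[of e] by (smt (verit) mult_neg_pos)
qed

text \<open>By compactness the Rayleigh quotient attains its minimum on the unit sphere of
  \<open>W\<close>, and first-order optimality makes the minimiser an eigenvector. Invariant
  subspaces are allowed because the spectral theorem uses an orthogonal complement as
  \<open>W\<close>; the whole space is used to identify \<open>lambda_min\<close>.\<close>

lemma sym_mat_rayleigh_minimum:
  fixes A :: "real^'n^'n"
  assumes sym: "sym_mat A" and W: "subspace W" "w0 \<in> W" "w0 \<noteq> 0"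
    and inv: "\<And>w. w \<in> W \<Longrightarrow> A *v w \<in> W"
  obtains v l where "v \<in> W" "norm v = 1" "A *v v = l *\<^sub>R v"
    "\<And>w. w \<in> W \<Longrightarrow> l * (norm w)\<^sup>2 \<le> w \<bullet> (A *v w)"
proof -
  let ?K = "sphere 0 1 \<inter> W"
  have "compact ?K"
    using W(1) by (intro compact_Int_closed closed_subspace) auto
  moreover have "w0 /\<^sub>R norm w0 \<in> ?K"
    using W(3) subspace_mul[OF W(1,2)] by simp
  then have "?K \<noteq> {}" by blast
  moreover have "continuous_on ?K (\<lambda>w. w \<bullet> (A *v w))"
    by (intro continuous_intros linear_continuous_on matrix_vector_mul_bounded_linear)
  ultimately obtain v where v: "v \<in> ?K" and vmin: "\<And>w. w \<in> ?K \<Longrightarrow> v \<bullet> (A *v v) \<le> w \<bullet> (A *v w)"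
    using continuous_attains_inf[of ?K "\<lambda>w. w \<bullet> (A *v w)"] by blast
  define l where "l = v \<bullet> (A *v v)"
  have low: "l * (norm w)\<^sup>2 \<le> w \<bullet> (A *v w)" if "w \<in> W" for w
  proof (cases "w = 0")
    case False
    then have "w /\<^sub>R norm w \<in> ?K" using subspace_mul[OF W(1) that] by simp
    from vmin[OF this] have "l \<le> (w \<bullet> (A *v w)) / (norm w)\<^sup>2"
      by (simp add: l_def matrix_vector_mult_scaleR power2_eq_square field_simps)
    then show ?thesis using False by (simp add: field_simps)
  qed simp
  \<comment> \<open>The residual of the eigenvalue equation, which stays in \<open>W\<close> by
    invariance. Perturbing the minimiser to \<open>v + e *\<^sub>R u\<close> gives an inequality in
    \<open>e\<close> with linear coefficient \<open>2 * (u \<bullet> u)\<close>, so the residual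
    must vanish.\<close>
  define u where "u = A *v v - l *\<^sub>R v"
  have vW: "v \<in> W" "norm v = 1" using v by auto
  have uW: "u \<in> W" unfolding u_def using vW W inv by (intro subspace_diff subspace_mul) auto
  have vv: "v \<bullet> v = 1" using vW by (simp add: norm_eq_1)
  have "0 \<le> 2 * e * (u \<bullet> u) + e\<^sup>2 * (u \<bullet> (A *v u) - l * (u \<bullet> u))" for e
  proof -
    have "v + e *\<^sub>R u \<in> W" using vW uW W by (intro subspace_add subspace_mul)
    from low[OF this]
    have "l * ((v + e *\<^sub>R u) \<bullet> (v + e *\<^sub>R u)) \<le> (v + e *\<^sub>R u) \<bullet> (A *v (v + e *\<^sub>R u))"
      by (simp add: power2_norm_eq_inner)
    moreover have "v \<bullet> (A *v u) = u \<bullet> (A *v v)"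
      by (metis inner_commute sym sym_mat_inner)
    moreover have "u \<bullet> (A *v v) = u \<bullet> u + l * (v \<bullet> u)"
      by (subst (3) u_def) (simp add: inner_diff_right inner_commute)
    ultimately show ?thesis
      by (simp add: matrix_vector_right_distrib matrix_vector_mult_scaleR inner_add_left
          inner_add_right l_def[symmetric] vv inner_commute[of u v] power2_eq_square algebra_simps)
  qed
  then have "u \<bullet> u = 0" by (rule quadratic_nonneg_imp_linear_coeff_zero) simp
  then have "A *v v = l *\<^sub>R v" by (simp add: u_def)
  from vW this low show ?thesis by (rule that)
qed

text \<open>Take an orthonormal set of eigenvectors of maximal cardinality, which exists because
  independence bounds the cardinality by the dimension. If it did not span, its orthogonal
  complement would contain one more unit eigenvector.\<close>

theorem sym_mat_spectral:
  fixes A :: "real^'n^'n"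
  assumes sym: "sym_mat A"
  obtains B l where "finite B" "pairwise orthogonal B" "\<And>b. b \<in> B \<Longrightarrow> norm b = 1"
    "span B = UNIV" "\<And>b. b \<in> B \<Longrightarrow> A *v b = l b *\<^sub>R b"
proof -
  define Q where "Q B \<longleftrightarrow> pairwise orthogonal B \<and> (\<forall>b\<in>B. norm b = 1 \<and> (\<exists>l. A *v b = l *\<^sub>R b))"
    for B :: "(real^'n) set"
  have bound: "finite B \<and> card B \<le> CARD('n)" if "Q B" for B
  proof -
    have "0 \<notin> B" using that by (force simp: Q_def)
    then have "independent B"
      using that pairwise_orthogonal_independent by (auto simp: Q_def)
    then show ?thesis using independent_bound by fastforce
  qed
  have "Q {}" by (simp add: Q_def)
  moreover have "\<forall>B. Q B \<longrightarrow> card B < Suc CARD('n)" using bound by (simp add: less_Suc_eq_le)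
  ultimately obtain B where B: "Q B" and Bmax: "\<And>B'. Q B' \<Longrightarrow> card B' \<le> card B"
    using ex_has_greatest_nat[of Q "{}" card] by blast
  have fin: "finite B" using bound B by blast
  have "span B = UNIV"
  proof (rule ccontr)
    assume "span B \<noteq> UNIV"
    then have "span B \<subset> span UNIV" by auto
    then obtain x where x: "x \<noteq> 0" "\<And>y. y \<in> span B \<Longrightarrow> orthogonal x y"
      by (rule orthogonal_to_subspace_exists_gen) blast
    let ?W = "{w. \<forall>b\<in>B. w \<bullet> b = 0}"
    have W: "subspace ?W" by (auto simp: subspace_def inner_add_left)
    have xW: "x \<in> ?W" using x(2) by (auto simp: orthogonal_def span_base)
    \<comment> \<open>Symmetry moves \<open>A\<close> onto the eigenvector \<open>b\<close>, which
      it only rescales, so the complement is invariant.\<close>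
    have inv: "A *v w \<in> ?W" if w: "w \<in> ?W" for w
    proof (intro CollectI ballI)
      fix b assume b: "b \<in> B"
      then obtain k where "A *v b = k *\<^sub>R b" using B by (auto simp: Q_def)
      then show "(A *v w) \<bullet> b = 0" using w b by (simp add: sym_mat_inner[OF sym])
    qed
    obtain v k where v: "v \<in> ?W" "norm v = 1" "A *v v = k *\<^sub>R v"
      by (rule sym_mat_rayleigh_minimum[OF sym W xW x(1) inv])
    have "v \<notin> B" using v by (auto simp: norm_eq_1)
    moreover have "Q (insert v B)"
      using B v by (auto simp: Q_def pairwise_insert orthogonal_def inner_commute)
    ultimately show False using Bmax[of "insert v B"] fin by simp
  qed
  moreover have "\<forall>b\<in>B. \<exists>l. A *v b = l *\<^sub>R b" using B by (simp add: Q_def)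
  then obtain l where "\<forall>b\<in>B. A *v b = l b *\<^sub>R b" by (rule bchoice[THEN exE])
  ultimately show ?thesis using fin B by (intro that[of B l]) (auto simp: Q_def)
qed

lemma matrix_eq_on_span:
  fixes A B :: "real^'n^'m"
  assumes "span S = UNIV" "\<And>b. b \<in> S \<Longrightarrow> A *v b = B *v b"
  shows "A = B"
proof -
  have "A *v x = B *v x" for x
    by (rule linear_eq_on[where B = S]) (use assms in auto)
  then show ?thesis by (simp add: matrix_eq)
qed

subsection \<open>The square root\<close>

lemma psd_mat_sqrt_exists:
  fixes A :: "real^'n^'n"
  assumes psd: "psd_mat A"
  shows "\<exists>S. psd_mat S \<and> S ** S = A"
proof -
  have sym: "sym_mat A" using psd by (simp add: psd_mat_def)
  obtain B l where B: "finite B" "pairwise orthogonal B" "\<And>b. b \<in> B \<Longrightarrow> norm b = 1"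
    "span B = UNIV" "\<And>b. b \<in> B \<Longrightarrow> A *v b = l b *\<^sub>R b"
    using sym_mat_spectral[OF sym] by metis
  have l0: "0 \<le> l b" if "b \<in> B" for b
  proof -
    have "0 \<le> b \<bullet> (A *v b)" using psd by (simp add: psd_mat_def)
    also have "\<dots> = l b" using B(3,5)[OF that] by (simp add: norm_eq_1)
    finally show ?thesis .
  qed
  \<comment> \<open>The root keeps the orthonormal eigenbasis of \<open>A\<close> and replaces each
    eigenvalue by its square root.\<close>
  define f where "f x = (\<Sum>b\<in>B. (sqrt (l b) * (x \<bullet> b)) *\<^sub>R b)" for x
  have "linear f"
    by (intro linearI)
       (auto simp: f_def inner_add_left algebra_simps sum.distrib scaleR_sum_right)
  then have S: "matrix f *v x = f x" for x by (simp add: matrix_works)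
  have fb: "f b = sqrt (l b) *\<^sub>R b" if "b \<in> B" for b
  proof -
    have "(sqrt (l b') * (b \<bullet> b')) *\<^sub>R b' = (if b' = b then sqrt (l b) *\<^sub>R b else 0)" if "b' \<in> B" for b'
      using that \<open>b \<in> B\<close> B(2) B(3)[of b]
      by (auto simp: pairwise_def orthogonal_def norm_eq_1)
    then show ?thesis
      using that B(1) by (simp add: f_def)
  qed
  have "matrix f ** matrix f = A"
  proof (rule matrix_eq_on_span[OF B(4)])
    fix b assume b: "b \<in> B"
    show "(matrix f ** matrix f) *v b = A *v b"
      using b l0[OF b]
      by (simp add: matrix_vector_mul_assoc[symmetric] S fb B(5) linear_scale[OF \<open>linear f\<close>])
  qed
  moreover have "psd_mat (matrix f)"
    unfolding psd_mat_def
  proof (intro conjI allI sym_matI)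
    show "(matrix f *v x) \<bullet> y = x \<bullet> (matrix f *v y)" for x y
      by (simp add: S f_def inner_sum_left inner_sum_right inner_commute algebra_simps)
    have "x \<bullet> (matrix f *v x) = (\<Sum>b\<in>B. sqrt (l b) * (x \<bullet> b)\<^sup>2)" for x
      by (simp add: S f_def inner_sum_right power2_eq_square mult.assoc)
    then show "0 \<le> x \<bullet> (matrix f *v x)" for x
      using l0 by (simp add: sum_nonneg)
  qed
  ultimately show ?thesis by blast
qed

text \<open>It suffices to compare both roots on an eigenbasis of \<open>S\<close>. If
  \<open>S\<close> has eigenvalue \<open>s\<close> at \<open>b\<close>, then
  \<open>(R + s)(R - s) b = 0\<close>, and a positive semidefinite \<open>R\<close> has no
  eigenvalue \<open>-s\<close> with \<open>s > 0\<close>.\<close>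

lemma psd_mat_sqrt_unique:
  fixes R S :: "real^'n^'n"
  assumes R: "psd_mat R" and S: "psd_mat S" and eq: "R ** R = S ** S"
  shows "R = S"
proof -
  have symR: "sym_mat R" and symS: "sym_mat S" using R S by (auto simp: psd_mat_def)
  obtain B l where B: "\<And>b. b \<in> B \<Longrightarrow> norm b = 1"
    "span B = UNIV" "\<And>b. b \<in> B \<Longrightarrow> S *v b = l b *\<^sub>R b"
    using sym_mat_spectral[OF symS] by metis
  show ?thesis
  proof (rule matrix_eq_on_span[OF B(2)])
    fix b assume b: "b \<in> B"
    let ?s = "l b"
    have Sb: "S *v b = ?s *\<^sub>R b" by (rule B(3)[OF b])
    have "0 \<le> b \<bullet> (S *v b)" using S by (simp add: psd_mat_def)
    then have s0: "0 \<le> ?s" using B(1)[OF b] by (simp add: Sb norm_eq_1)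
    have RR: "R *v (R *v b) = ?s\<^sup>2 *\<^sub>R b"
      using eq by (metis matrix_vector_mul_assoc Sb matrix_vector_mult_scaleR scaleR_scaleR power2_eq_square)
    show "R *v b = S *v b"
    \<comment> \<open>For eigenvalue 0 there is no sign contradiction; there the norm of
      \<open>R *v b\<close> vanishes directly, since its square is
      \<open>b \<bullet> (R *v (R *v b))\<close>.\<close>
    proof (cases "?s = 0")
      case True
      have "(R *v b) \<bullet> (R *v b) = b \<bullet> (R *v (R *v b))" by (rule sym_mat_inner[OF symR])
      then show ?thesis using RR True Sb by simp
    next
      case False
      define w where "w = R *v b - ?s *\<^sub>R b"
      have "R *v w = - (?s *\<^sub>R w)"
        by (simp add: w_def matrix_vector_mult_diff_distrib matrix_vector_mult_scaleR RR
            scaleR_diff_right power2_eq_square)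
      moreover have "0 \<le> w \<bullet> (R *v w)" using R by (simp add: psd_mat_def)
      ultimately have "?s * (w \<bullet> w) \<le> 0" by simp
      then have "w \<bullet> w \<le> 0" using False s0 by (simp add: mult_le_0_iff)
      then have "w = 0" by (metis inner_ge_zero inner_eq_zero_iff order_antisym)
      then show ?thesis by (simp add: w_def Sb)
    qed
  qed
qed

text \<open>Existence and uniqueness together give the definite description in \<open>msqrt\<close>
  its meaning.\<close>

lemma msqrt_psd_square:
  fixes A :: "real^'n^'n"
  assumes "psd_mat A"
  shows "psd_mat (msqrt A) \<and> msqrt A ** msqrt A = A"
  unfolding msqrt_def
  by (rule theI') (metis psd_mat_sqrt_exists[OF assms] psd_mat_sqrt_unique)

lemmas psd_mat_msqrt = msqrt_psd_square[THEN conjunct1]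
  and msqrt_square = msqrt_psd_square[THEN conjunct2]

subsection \<open>Positive definite matrices\<close>

lemma pd_mat_imp_psd_mat: "pd_mat A \<Longrightarrow> psd_mat A"
  unfolding pd_mat_def psd_mat_def by (metis inner_zero_left less_eq_real_def)

lemma invertible_iff_inj_mult:
  fixes A :: "real^'n^'n"
  shows "invertible A \<longleftrightarrow> (\<forall>x. A *v x = 0 \<longrightarrow> x = 0)"
  by (metis invertible_left_inverse matrix_left_invertible_ker)

lemma matrix_inv_mult:
  fixes A :: "real^'n^'n"
  assumes "invertible A"
  shows "A ** matrix_inv A = mat 1" "matrix_inv A ** A = mat 1"
  using someI_ex[OF assms[unfolded invertible_def]] by (simp_all add: matrix_inv_def)

lemma matrix_inv_vector_mult:
  fixes A :: "real^'n^'n"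
  assumes "invertible A"
  shows "A *v (matrix_inv A *v x) = x" "matrix_inv A *v (A *v x) = x"
  using matrix_inv_mult[OF assms] by (simp_all add: matrix_vector_mul_assoc)

lemma sym_mat_matrix_inv:
  fixes A :: "real^'n^'n"
  assumes "sym_mat A" "invertible A"
  shows "sym_mat (matrix_inv A)"
  by (rule sym_matI) (metis assms sym_mat_inner matrix_inv_vector_mult)

lemma pd_mat_invertible: "pd_mat A \<Longrightarrow> invertible A"
  unfolding invertible_iff_inj_mult pd_mat_def by (metis inner_zero_right less_irrefl)

lemma invertible_msqrt:
  fixes A :: "real^'n^'n"
  assumes "pd_mat A"
  shows "invertible (msqrt A)"
  unfolding invertible_iff_inj_mult
proof (intro allI impI)
  fix x assume "msqrt A *v x = 0"
  then have "A *v x = 0"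
    using msqrt_square[OF pd_mat_imp_psd_mat[OF assms]]
    by (metis matrix_vector_mul_assoc matrix_vector_mult_0_right)
  then show "x = 0" using pd_mat_invertible[OF assms] by (simp add: invertible_iff_inj_mult)
qed

text \<open>The minimum of the Rayleigh quotient over the whole space is itself an eigenvalue and
  bounds every other one from below, so the infimum in \<open>lambda_min\<close> is attained
  there.\<close>

lemma lambda_min_le:
  fixes A :: "real^'n^'n"
  assumes pd: "pd_mat A"
  shows "0 < lambda_min A" and "lambda_min A * (norm w)\<^sup>2 \<le> w \<bullet> (A *v w)"
proof -
  have sym: "sym_mat A" using pd by (simp add: pd_mat_def)
  obtain v l where v: "norm v = 1" "A *v v = l *\<^sub>R v"
    and low: "\<And>w. l * (norm w)\<^sup>2 \<le> w \<bullet> (A *v w)"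
    using sym_mat_rayleigh_minimum[OF sym subspace_UNIV UNIV_I, of "axis undefined 1"]
    by (metis UNIV_I axis_eq_0_iff one_neq_zero)
  have v0: "v \<noteq> 0" using v by auto
  have "lambda_min A = l"
    unfolding lambda_min_def
  proof (rule cInf_eq_minimum)
    show "l \<in> {l. \<exists>v. v \<noteq> 0 \<and> A *v v = l *\<^sub>R v}" using v v0 by blast
    fix k assume "k \<in> {l. \<exists>v. v \<noteq> 0 \<and> A *v v = l *\<^sub>R v}"
    then obtain x where x: "x \<noteq> 0" "A *v x = k *\<^sub>R x" by blast
    from low[of x] show "l \<le> k" using x by (simp add: power2_norm_eq_inner)
  qed
  moreover have "0 < v \<bullet> (A *v v)" using pd v0 by (simp add: pd_mat_def)
  then have "0 < l" using v by (simp add: norm_eq_1)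
  ultimately show "0 < lambda_min A" "lambda_min A * (norm w)\<^sup>2 \<le> w \<bullet> (A *v w)"
    using low by auto
qed

subsection \<open>The Monge matrix\<close>

text \<open>These three facts are all that is used of the Monge map: as a positive semidefinite,
  invertible matrix it maximises correlation, and the last identity says that it carries covariance
  \<open>S1\<close> to \<open>S2\<close>.\<close>

lemma monge_mat_properties:
  fixes S1 S2 :: "real^'n^'n"
  assumes pd1: "pd_mat S1" and pd2: "pd_mat S2"
  shows "psd_mat (monge_mat S1 S2)" "invertible (monge_mat S1 S2)"
    "monge_mat S1 S2 ** S1 ** monge_mat S1 S2 = S2"
proof -
  define S where "S = msqrt S1"
  define J where "J = matrix_inv S"
  define R where "R = msqrt (S ** S2 ** S)"
  have T: "monge_mat S1 S2 = J ** R ** J" by (simp add: monge_mat_def S_def J_def R_def)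
  have S: "psd_mat S" "S ** S = S1"
    using pd1 pd_mat_imp_psd_mat psd_mat_msqrt msqrt_square by (auto simp: S_def)
  have symS: "sym_mat S" using S by (simp add: psd_mat_def)
  have Sinv: "invertible S" using pd1 by (simp add: S_def invertible_msqrt)
  have SJ: "S ** J = mat 1" "J ** S = mat 1"
    using matrix_inv_mult[OF Sinv] by (auto simp: J_def)
  have symJ: "sym_mat J" using symS Sinv by (simp add: J_def sym_mat_matrix_inv)
  have Jinv: "invertible J" using SJ by (auto simp: invertible_def)
  \<comment> \<open>Congruence by the injective symmetric \<open>S\<close> preserves positive
    definiteness; hence the root \<open>R\<close> is a genuine one and is invertible.\<close>
  have pdM: "pd_mat (S ** S2 ** S)"
    unfolding pd_mat_def
  proof (intro conjI sym_matI allI impI)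
    have sym2: "sym_mat S2" using pd2 by (simp add: pd_mat_def)
    show "(S ** S2 ** S *v x) \<bullet> y = x \<bullet> (S ** S2 ** S *v y)" for x y
      by (simp add: matrix_vector_mul_assoc[symmetric] sym_mat_inner symS sym2)
    fix x :: "real^'n" assume "x \<noteq> 0"
    then have "S *v x \<noteq> 0" using Sinv by (auto simp: invertible_iff_inj_mult)
    then have "0 < (S *v x) \<bullet> (S2 *v (S *v x))" using pd2 by (simp add: pd_mat_def)
    then show "0 < x \<bullet> (S ** S2 ** S *v x)"
      by (simp add: matrix_vector_mul_assoc[symmetric] sym_mat_inner symS)
  qed
  have R: "psd_mat R" "R ** R = S ** S2 ** S"
    using pd_mat_imp_psd_mat[OF pdM] psd_mat_msqrt msqrt_square by (auto simp: R_def)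
  have symR: "sym_mat R" using R by (simp add: psd_mat_def)
  show "psd_mat (monge_mat S1 S2)"
    unfolding T psd_mat_def
  proof (intro conjI sym_matI allI)
    show "(J ** R ** J *v x) \<bullet> y = x \<bullet> (J ** R ** J *v y)" for x y
      by (simp add: matrix_vector_mul_assoc[symmetric] sym_mat_inner symJ symR)
    fix x
    have "0 \<le> (J *v x) \<bullet> (R *v (J *v x))" using R by (simp add: psd_mat_def)
    then show "0 \<le> x \<bullet> (J ** R ** J *v x)"
      by (simp add: matrix_vector_mul_assoc[symmetric] sym_mat_inner symJ)
  qed
  show "invertible (monge_mat S1 S2)"
    unfolding T using Jinv invertible_msqrt[OF pdM] by (simp add: R_def invertible_mult)
  \<comment> \<open>Splitting \<open>S1\<close> as \<open>S ** S\<close> lets both factors cancel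
    against the inner copies of \<open>J\<close>, which leaves \<open>R ** R\<close> in the
    middle.\<close>
  have "J ** R ** J ** S1 ** (J ** R ** J) = J ** R ** (J ** S) ** (S ** J) ** R ** J"
    unfolding S(2)[symmetric] by (simp add: matrix_mul_assoc)
  also have "\<dots> = J ** (R ** R) ** J" by (simp add: SJ matrix_mul_assoc)
  also have "\<dots> = (J ** S) ** S2 ** (S ** J)" by (simp add: R(2) matrix_mul_assoc)
  also have "\<dots> = S2" by (simp add: SJ)
  finally show "monge_mat S1 S2 ** S1 ** monge_mat S1 S2 = S2" by (simp add: T)
qed

section \<open>Second moments\<close>

text \<open>The weak form of \<open>E[X X^T] = C\<close>, which is the covariance for a centered
  law. Testing with pairs of vectors bundles integrability with the value and makes linear images a
  matter of transposing onto the test vectors.\<close>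

definition has_second_moment :: "'a measure \<Rightarrow> ('a \<Rightarrow> real^'n) \<Rightarrow> real^'n^'n \<Rightarrow> bool" where
  "has_second_moment M X C \<longleftrightarrow> X \<in> borel_measurable M \<and>
    (\<forall>u v. has_bochner_integral M (\<lambda>\<omega>. (u \<bullet> X \<omega>) * (v \<bullet> X \<omega>)) (u \<bullet> (C *v v)))"

lemma has_second_moment_measurable [measurable_dest]:
  "has_second_moment M X C \<Longrightarrow> X \<in> borel_measurable M"
  by (simp add: has_second_moment_def)

lemma has_second_moment_inner:
  "has_second_moment M X C \<Longrightarrow>
    has_bochner_integral M (\<lambda>\<omega>. (u \<bullet> X \<omega>) * (v \<bullet> X \<omega>)) (u \<bullet> (C *v v))"
  by (simp add: has_second_moment_def)

lemma borel_measurable_matrix_vector_mult [measurable (raw)]: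
  fixes A :: "real^'n^'m"
  assumes "f \<in> borel_measurable M"
  shows "(\<lambda>x. A *v f x) \<in> borel_measurable M"
proof -
  have "(\<lambda>x. A *v x) \<in> borel_measurable borel"
    by (intro borel_measurable_continuous_onI linear_continuous_on matrix_vector_mul_bounded_linear)
  from measurable_compose[OF assms this] show ?thesis .
qed

lemma has_second_moment_linear:
  fixes A :: "real^'n^'n"
  assumes X: "has_second_moment M X C"
  shows "has_second_moment M (\<lambda>\<omega>. A *v X \<omega>) (A ** C ** transpose A)"
  unfolding has_second_moment_def
proof (intro conjI allI)
  show "(\<lambda>\<omega>. A *v X \<omega>) \<in> borel_measurable M" using X by measurable
  fix u v
  have *: "y \<bullet> (A *v x) = (transpose A *v y) \<bullet> x" for x y
    by (simp add: dot_lmul_matrix)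
  show "has_bochner_integral M (\<lambda>\<omega>. (u \<bullet> (A *v X \<omega>)) * (v \<bullet> (A *v X \<omega>)))
      (u \<bullet> (A ** C ** transpose A *v v))"
    unfolding * matrix_vector_mul_assoc[symmetric] by (rule has_second_moment_inner[OF X])
qed

lemma has_second_moment_distr:
  assumes f [measurable]: "f \<in> borel_measurable M"
  shows "has_second_moment (distr M borel f) (\<lambda>x. x) C \<longleftrightarrow> has_second_moment M f C"
  by (simp add: has_second_moment_def has_bochner_integral_iff integrable_distr_eq integral_distr)

text \<open>Expanding in coordinates shows that the mean of a quadratic form depends on
  \<open>X\<close> only through \<open>C\<close>. This is how equality of laws enters the duality
  argument.\<close>

lemma has_second_moment_quadratic:
  fixes K C :: "real^'n^'n"
  assumes X: "has_second_moment M X C"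
  shows "has_bochner_integral M (\<lambda>\<omega>. X \<omega> \<bullet> (K *v X \<omega>))
    (\<Sum>i\<in>UNIV. \<Sum>j\<in>UNIV. K $ i $ j * C $ i $ j)"
proof -
  have "has_bochner_integral M (\<lambda>\<omega>. K $ i $ j * ((axis i 1 \<bullet> X \<omega>) * (axis j 1 \<bullet> X \<omega>)))
    (K $ i $ j * (axis i 1 \<bullet> (C *v axis j 1)))" for i j
    by (intro has_bochner_integral_mult_right has_second_moment_inner[OF X])
  then have "has_bochner_integral M (\<lambda>\<omega>. K $ i $ j * (X \<omega> $ i * X \<omega> $ j)) (K $ i $ j * C $ i $ j)" for i j
    by (simp add: inner_axis' matrix_vector_mult_basis column_def)
  then have "has_bochner_integral M (\<lambda>\<omega>. \<Sum>i\<in>UNIV. \<Sum>j\<in>UNIV. K $ i $ j * (X \<omega> $ i * X \<omega> $ j))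
    (\<Sum>i\<in>UNIV. \<Sum>j\<in>UNIV. K $ i $ j * C $ i $ j)"
    by (intro has_bochner_integral_sum)
  moreover have "x \<bullet> (K *v x) = (\<Sum>i\<in>UNIV. \<Sum>j\<in>UNIV. K $ i $ j * (x $ i * x $ j))" for x
    by (simp add: inner_vec_def matrix_vector_mult_def sum_distrib_left algebra_simps)
  ultimately show ?thesis by simp
qed

lemma has_second_moment_quadratic_cong:
  assumes "has_second_moment M X C" "has_second_moment M Y C"
  shows "integral\<^sup>L M (\<lambda>\<omega>. X \<omega> \<bullet> (K *v X \<omega>)) = integral\<^sup>L M (\<lambda>\<omega>. Y \<omega> \<bullet> (K *v Y \<omega>))"
  by (simp add: has_second_moment_quadratic[OF assms(1), THEN has_bochner_integral_integral_eq]
      has_second_moment_quadratic[OF assms(2), THEN has_bochner_integral_integral_eq])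

lemma has_second_moment_integrable_quadratic:
  assumes "has_second_moment M X C"
  shows "integrable M (\<lambda>\<omega>. X \<omega> \<bullet> (K *v X \<omega>))"
  using has_second_moment_quadratic[OF assms] by (auto simp: has_bochner_integral_iff)

lemma has_second_moment_integrable_norm_square:
  fixes X :: "'a \<Rightarrow> real^'n"
  assumes "has_second_moment M X C"
  shows "integrable M (\<lambda>\<omega>. (norm (X \<omega>))\<^sup>2)"
  using has_second_moment_integrable_quadratic[OF assms, of "mat 1"]
  by (simp add: power2_norm_eq_inner)

text \<open>Nothing is assumed about the joint law, so the product is dominated pointwise by
  \<open>(norm x)\<^sup>2 + (norm y)\<^sup>2\<close>.\<close>

lemma has_second_moment_integrable_cross:
  fixes X Y :: "'a \<Rightarrow> real^'n"
  assumes X: "has_second_moment M X C" and Y: "has_second_moment M Y D"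
  shows "integrable M (\<lambda>\<omega>. X \<omega> \<bullet> Y \<omega>)"
proof (rule Bochner_Integration.integrable_bound)
  show "integrable M (\<lambda>\<omega>. (norm (X \<omega>))\<^sup>2 + (norm (Y \<omega>))\<^sup>2)"
    using X Y by (intro Bochner_Integration.integrable_add has_second_moment_integrable_norm_square)
  show "(\<lambda>\<omega>. X \<omega> \<bullet> Y \<omega>) \<in> borel_measurable M" using X Y by measurable
  have "\<bar>x \<bullet> y\<bar> \<le> (norm x)\<^sup>2 + (norm y)\<^sup>2" for x y :: "real^'n"
  proof -
    have "\<bar>x \<bullet> y\<bar> \<le> norm x * norm y" by (rule Cauchy_Schwarz_ineq2)
    also have "\<dots> \<le> (norm x)\<^sup>2 + (norm y)\<^sup>2"
      using sum_squares_bound[of "norm x" "norm y"] mult_nonneg_nonneg[OF norm_ge_zero norm_ge_zero, of x y]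
      by linarith
    finally show ?thesis .
  qed
  then show "AE \<omega> in M. norm (X \<omega> \<bullet> Y \<omega>) \<le> norm ((norm (X \<omega>))\<^sup>2 + (norm (Y \<omega>))\<^sup>2)"
    by simp
qed

subsection \<open>Gaussian measures\<close>

text \<open>Fubini for product integrands: \<open>lborel\<close> is the image of the product of
  one-dimensional Lebesgue measures under the coordinate map.\<close>

lemma has_bochner_integral_lborel_prod:
  fixes f :: "'b::euclidean_space \<Rightarrow> real \<Rightarrow> real"
  assumes f: "\<And>b. b \<in> Basis \<Longrightarrow> has_bochner_integral lborel (f b) (m b)"
  shows "has_bochner_integral lborel (\<lambda>x::'b. \<Prod>b\<in>Basis. f b (x \<bullet> b)) (\<Prod>b\<in>Basis. m b)"
proof -
  interpret product_sigma_finite "\<lambda>_::'b. lborel :: real measure" ..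
  have int: "\<And>b. b \<in> Basis \<Longrightarrow> integrable lborel (f b)"
    and m: "\<And>b. b \<in> Basis \<Longrightarrow> integral\<^sup>L lborel (f b) = m b"
    using f by (auto simp: has_bochner_integral_iff)
  have [measurable]: "f b \<in> borel_measurable borel" if "b \<in> Basis" for b
    using borel_measurable_integrable[OF int[OF that]] by simp
  have coord: "(\<Prod>b\<in>Basis. f b ((\<Sum>b\<in>Basis. x b *\<^sub>R b) \<bullet> b)) = (\<Prod>b\<in>Basis. f b (x b))"
    for x :: "'b \<Rightarrow> real"
    by (intro prod.cong) simp_all
  show ?thesis
    unfolding lborel_eq[where 'a = 'b]
  proof (rule has_bochner_integral_distr)
    show "has_bochner_integral (\<Pi>\<^sub>M b\<in>Basis. lborel)
      (\<lambda>x. \<Prod>b\<in>Basis. f b ((\<Sum>b\<in>Basis. x b *\<^sub>R b) \<bullet> b)) (\<Prod>b\<in>Basis. m b)"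
      unfolding coord has_bochner_integral_iff
      using product_integrable_prod[OF finite_Basis int] product_integral_prod[OF finite_Basis int] m
      by simp
  qed measurable
qed

lemma prod_Basis_vec:
  fixes f :: "real^'n \<Rightarrow> 'b::comm_monoid_mult"
  shows "(\<Prod>b\<in>Basis. f b) = (\<Prod>i\<in>UNIV. f (axis i 1))"
proof -
  have Basis: "(Basis :: (real^'n) set) = (\<lambda>i. axis i 1) ` UNIV" by (auto simp: Basis_vec_def)
  have "inj (\<lambda>i::'n. axis i (1::real))" by (auto simp: inj_on_def axis_eq_axis)
  from prod.reindex[OF this, of f] show ?thesis by (simp add: Basis)
qed

lemma std_gauss_moment_coordinates:
  "has_bochner_integral (std_gauss :: (real^'n) measure) (\<lambda>x. x $ i * x $ j) (if i = j then 1 else 0)"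
proof -
  \<comment> \<open>\<open>k\<close> lists the exponents of the monomial
    \<open>x $ i * x $ j\<close>, and \<open>m\<close> the standard normal moments of orders 0, 1,
    2, namely 1, 0, 1. For \<open>i = j\<close> only orders 0 and 2 occur; otherwise a factor of
    order 1 makes the product vanish.\<close>
  define k where "k l = (if l = i then 1 else 0) + (if l = j then 1 else (0::nat))" for l
  define m where "m n = (if n = 1 then 0 else 1 :: real)" for n :: nat
  have k2: "k l \<le> 2" for l by (simp add: k_def)
  have mom: "has_bochner_integral lborel (\<lambda>x. std_normal_density x * x ^ n) (m n)" if "n \<le> 2" for n
  proof -
    from that have "n = 0 \<or> n = 1 \<or> n = 2" by linarith
    then consider "n = 0" | "n = 1" | "n = 2" by blast
    then show ?thesis
    proof cases
      case 1 then show ?thesis using std_normal_moment_even[of 0] by (simp add: m_def)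
    next
      case 2 then show ?thesis using std_normal_moment_odd[of 0] by (simp add: m_def)
    next
      case 3 then show ?thesis using std_normal_moment_even[of 1] by (simp add: m_def)
    qed
  qed
  \<comment> \<open>The inner sum only looks up the exponent belonging to the basis vector
    \<open>b\<close>: exactly one index \<open>l\<close> satisfies
    \<open>b = axis l 1\<close>.\<close>
  have "has_bochner_integral lborel
     (\<lambda>x::real^'n. \<Prod>b\<in>Basis. std_normal_density (x \<bullet> b) * (x \<bullet> b) ^ (\<Sum>l\<in>UNIV. if b = axis l 1 then k l else 0))
     (\<Prod>b\<in>(Basis::(real^'n) set). m (\<Sum>l\<in>UNIV. if b = axis l 1 then k l else 0))"
    by (rule has_bochner_integral_lborel_prod, rule mom)
       (auto simp: Basis_vec_def axis_eq_axis k2)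
  then have "has_bochner_integral lborel
     (\<lambda>x::real^'n. \<Prod>l\<in>UNIV. std_normal_density (x $ l) * (x $ l) ^ k l) (\<Prod>l\<in>UNIV. m (k l))"
    by (simp add: prod_Basis_vec axis_eq_axis inner_axis)
  moreover have "(\<Prod>l\<in>UNIV. std_normal_density (x $ l) * (x $ l) ^ k l) =
      (\<Prod>l\<in>UNIV. std_normal_density (x $ l)) *\<^sub>R (x $ i * x $ j)" for x :: "real^'n"
  proof -
    have "(\<Prod>l\<in>UNIV. (x $ l) ^ k l) =
      (\<Prod>l\<in>UNIV. if l = i then x $ l else 1) * (\<Prod>l\<in>UNIV. if l = j then x $ l else 1)"
      unfolding prod.distrib[symmetric] by (intro prod.cong) (auto simp: k_def)
    then show ?thesis by (simp add: prod.distrib)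
  qed
  moreover have "(\<Prod>l\<in>UNIV. m (k l)) = (if i = j then 1 else 0)"
    by (auto simp: m_def k_def intro!: prod.neutral)
  ultimately show ?thesis
    unfolding std_gauss_def
    by (intro has_bochner_integral_density) (simp_all add: prod_nonneg)
qed

lemma has_second_moment_std_gauss:
  "has_second_moment (std_gauss :: (real^'n) measure) (\<lambda>x. x) (mat 1)"
  unfolding has_second_moment_def
proof (intro conjI allI)
  show "(\<lambda>x. x) \<in> borel_measurable (std_gauss :: (real^'n) measure)" by (simp add: std_gauss_def)
  fix u v :: "real^'n"
  have "has_bochner_integral std_gauss (\<lambda>x. \<Sum>i\<in>UNIV. \<Sum>j\<in>UNIV. u $ i * v $ j * (x $ i * x $ j))
    (\<Sum>i\<in>UNIV. \<Sum>j\<in>UNIV. u $ i * v $ j * (if i = j then 1 else 0))"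
    by (intro has_bochner_integral_sum has_bochner_integral_mult_right std_gauss_moment_coordinates)
  then show "has_bochner_integral std_gauss (\<lambda>x. (u \<bullet> x) * (v \<bullet> x)) (u \<bullet> (mat 1 *v v))"
    by (simp add: inner_vec_def sum_product algebra_simps if_distrib cong: if_cong)
qed

lemma has_second_moment_gaussian:
  assumes "psd_mat S"
  shows "has_second_moment (gaussian S) (\<lambda>x. x) S"
proof -
  have "has_second_moment std_gauss (\<lambda>x. msqrt S *v x) S"
    using has_second_moment_linear[OF has_second_moment_std_gauss, of "msqrt S"]
      msqrt_square[OF assms] psd_mat_msqrt[OF assms]
    by (simp add: psd_mat_def sym_mat_def)
  then show ?thesis
    unfolding gaussian_def by (subst has_second_moment_distr) (auto dest: has_second_moment_measurable)
qed

section \<open>Stability of the Monge map\<close>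

text \<open>In the mixed term \<open>B\<close> cancels against its inverse. Hence only
  \<open>x \<bullet> y\<close> depends on the coupling of \<open>x\<close> and \<open>y\<close>; the
  outer terms see one marginal each.\<close>

lemma inverse_quadratic_expand:
  fixes B :: "real^'n^'n"
  assumes "sym_mat B" "invertible B"
  shows "(B *v x - y) \<bullet> (matrix_inv B *v (B *v x - y)) =
    x \<bullet> (B *v x) - 2 * (x \<bullet> y) + y \<bullet> (matrix_inv B *v y)"
proof -
  have "(B *v x) \<bullet> (matrix_inv B *v y) = x \<bullet> y"
    using assms by (simp add: sym_mat_inner matrix_inv_vector_mult)
  then show ?thesis
    using assms(2)
    by (simp add: matrix_vector_mult_diff_distrib matrix_inv_vector_mult inner_diff_left
        inner_diff_right inner_commute)
qed

text \<open>With \<open>w = B *v v\<close> the quadratic form is \<open>w \<bullet> v\<close>, so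
  both comparisons reduce to norm estimates between \<open>w\<close> and \<open>v\<close>, which
  differ by at most \<open>c * norm v\<close>.\<close>

lemma near_identity_inverse_bounds:
  fixes B :: "real^'n^'n"
  assumes c: "0 < c" "c < 1" and near: "\<And>v. norm (B *v v - v) \<le> c * norm v"
  shows "invertible B"
    and "(norm w)\<^sup>2 \<le> (1 + c) * (w \<bullet> (matrix_inv B *v w))"
    and "(1 - c) * (w \<bullet> (matrix_inv B *v w)) \<le> (norm w)\<^sup>2"
proof -
  have low: "(1 - c) * norm v \<le> norm (B *v v)" for v
    using near[of v] norm_triangle_ineq3[of "B *v v" v] by (simp add: algebra_simps)
  show inv: "invertible B"
    unfolding invertible_iff_inj_mult
  proof (intro allI impI)
    fix x assume "B *v x = 0"
    then show "x = 0" using low[of x] c by (simp add: mult_le_0_iff)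
  qed
  define v where "v = matrix_inv B *v w"
  have w: "w = B *v v" using inv by (simp add: v_def matrix_inv_vector_mult)
  have "w \<bullet> v \<le> norm w * norm v" by (rule norm_cauchy_schwarz)
  then have "(1 - c) * (w \<bullet> v) \<le> norm w * ((1 - c) * norm v)"
    using c mult_left_mono[of "w \<bullet> v" "norm w * norm v" "1 - c"] by (simp add: algebra_simps)
  also have "\<dots> \<le> norm w * norm w" using low[of v] by (intro mult_left_mono) (auto simp: w)
  finally show "(1 - c) * (w \<bullet> (matrix_inv B *v w)) \<le> (norm w)\<^sup>2"
    by (simp add: v_def power2_eq_square)
  have "(norm (w - v))\<^sup>2 \<le> (c * norm v)\<^sup>2"
    using near[of v] by (intro power_mono) (auto simp: w)
  \<comment> \<open>Expand the square. Below, \<open>(1 - c) * (w \<bullet> v)\<close> is shown to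
    be at most the subtracted term, and \<open>2 - (1 - c) = 1 + c\<close> gives the factor.\<close>
  then have 1: "(norm w)\<^sup>2 \<le> 2 * (w \<bullet> v) - (1 - c\<^sup>2) * (norm v)\<^sup>2"
    by (simp add: power2_norm_eq_inner power_mult_distrib inner_diff_left inner_diff_right
        inner_commute algebra_simps)
  have "(w - v) \<bullet> v \<le> norm (w - v) * norm v" by (rule norm_cauchy_schwarz)
  also have "\<dots> \<le> c * norm v * norm v" using near[of v] by (intro mult_right_mono) (auto simp: w)
  finally have "w \<bullet> v \<le> (1 + c) * (norm v)\<^sup>2"
    by (simp add: inner_diff_left power2_norm_eq_inner[symmetric] algebra_simps power2_eq_square)
  then have "(1 - c) * (w \<bullet> v) \<le> (1 - c) * ((1 + c) * (norm v)\<^sup>2)"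
    using c by (intro mult_left_mono) auto
  with 1 show "(norm w)\<^sup>2 \<le> (1 + c) * (w \<bullet> (matrix_inv B *v w))"
    by (simp add: v_def[symmetric] algebra_simps power2_eq_square)
qed

text \<open>Turns mean-square smallness into an operator norm bound. By symmetry
  \<open>(A *v u) \<bullet> X = u \<bullet> (A *v X)\<close>; the mean square of this is at least
  \<open>lambda_min C * (norm (A *v u))\<^sup>2\<close>, and by Cauchy-Schwarz at most
  \<open>(norm u)\<^sup>2 * c\<^sup>2 * lambda_min C\<close>. The eigenvalue cancels.\<close>

lemma L2norm_linear_le_imp_norm_le:
  fixes A C :: "real^'n^'n"
  assumes X: "has_second_moment M X C" and C: "pd_mat C" and c: "0 \<le> c"
    and sym: "sym_mat A"
    and le: "L2norm M (\<lambda>\<omega>. A *v X \<omega>) \<le> c * sqrt (lambda_min C)"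
  shows "norm (A *v u) \<le> c * norm u"
proof -
  note lam = lambda_min_le[OF C]
  have AX: "has_second_moment M (\<lambda>\<omega>. A *v X \<omega>) (A ** C ** transpose A)"
    using X by (rule has_second_moment_linear)
  have int2: "integrable M (\<lambda>\<omega>. (norm (A *v X \<omega>))\<^sup>2)"
    by (rule has_second_moment_integrable_norm_square[OF AX])
  have "0 \<le> integral\<^sup>L M (\<lambda>\<omega>. (norm (A *v X \<omega>))\<^sup>2)" by simp
  moreover have "(L2norm M (\<lambda>\<omega>. A *v X \<omega>))\<^sup>2 \<le> (c * sqrt (lambda_min C))\<^sup>2"
    using le by (intro power_mono) (simp_all add: L2norm_def)
  ultimately have E: "integral\<^sup>L M (\<lambda>\<omega>. (norm (A *v X \<omega>))\<^sup>2) \<le> c\<^sup>2 * lambda_min C"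
    using lam(1) by (simp add: L2norm_def power_mult_distrib)
  have hb: "has_bochner_integral M (\<lambda>\<omega>. ((A *v u) \<bullet> X \<omega>) * ((A *v u) \<bullet> X \<omega>)) ((A *v u) \<bullet> (C *v (A *v u)))"
    by (rule has_second_moment_inner[OF X])
  have "lambda_min C * (norm (A *v u))\<^sup>2 \<le> (A *v u) \<bullet> (C *v (A *v u))" by (rule lam(2))
  also have "\<dots> = integral\<^sup>L M (\<lambda>\<omega>. ((A *v u) \<bullet> X \<omega>) * ((A *v u) \<bullet> X \<omega>))"
    using hb by (simp add: has_bochner_integral_integral_eq)
  also have "\<dots> \<le> integral\<^sup>L M (\<lambda>\<omega>. (norm u)\<^sup>2 * (norm (A *v X \<omega>))\<^sup>2)"
  proof (rule integral_mono)
    show "integrable M (\<lambda>\<omega>. ((A *v u) \<bullet> X \<omega>) * ((A *v u) \<bullet> X \<omega>))"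
      using hb by (auto simp: has_bochner_integral_iff)
    show "integrable M (\<lambda>\<omega>. (norm u)\<^sup>2 * (norm (A *v X \<omega>))\<^sup>2)" using int2 by simp
    fix \<omega>
    show "((A *v u) \<bullet> X \<omega>) * ((A *v u) \<bullet> X \<omega>) \<le> (norm u)\<^sup>2 * (norm (A *v X \<omega>))\<^sup>2"
      using Cauchy_Schwarz_ineq[of u "A *v X \<omega>"]
      by (simp add: sym_mat_inner[OF sym] power2_norm_eq_inner) (simp add: power2_eq_square)
  qed
  also have "\<dots> \<le> (norm u)\<^sup>2 * (c\<^sup>2 * lambda_min C)"
    using E by (simp add: mult_left_mono)
  finally have "lambda_min C * (norm (A *v u))\<^sup>2 \<le> lambda_min C * (c * norm u)\<^sup>2"
    by (simp add: power_mult_distrib algebra_simps)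
  then have "(norm (A *v u))\<^sup>2 \<le> (c * norm u)\<^sup>2" using lam(1) by simp
  then show ?thesis using c by (simp add: abs_le_square_iff[symmetric])
qed

text \<open>Integrate the nonnegative form \<open>(Tx - y) \<bullet> T\<^sup>-\<^sup>1 (Tx - y)\<close>:
  its terms \<open>x \<bullet> Tx\<close> and \<open>y \<bullet> T\<^sup>-\<^sup>1 y\<close> have the same mean, since \<open>Y\<close> and \<open>TX\<close>
  share their second moments.\<close>

lemma psd_mat_maximises_correlation:
  fixes T :: "real^'n^'n"
  assumes X: "has_second_moment M X C" and Y: "has_second_moment M Y D"
    and TX: "has_second_moment M (\<lambda>\<omega>. T *v X \<omega>) D"
    and T: "psd_mat T" "invertible T"
  shows "integral\<^sup>L M (\<lambda>\<omega>. X \<omega> \<bullet> Y \<omega>) \<le> integral\<^sup>L M (\<lambda>\<omega>. X \<omega> \<bullet> (T *v X \<omega>))"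
proof -
  let ?K = "matrix_inv T"
  have sym: "sym_mat T" using T by (simp add: psd_mat_def)
  have nonneg: "0 \<le> z \<bullet> (?K *v z)" for z
  proof -
    have "0 \<le> (?K *v z) \<bullet> (T *v (?K *v z))" using T(1) by (simp add: psd_mat_def)
    then show ?thesis using T(2) by (simp add: matrix_inv_vector_mult inner_commute)
  qed
  note [simp] = has_second_moment_integrable_quadratic[OF X] has_second_moment_integrable_quadratic[OF Y]
    has_second_moment_integrable_cross[OF X Y]
  have "integral\<^sup>L M (\<lambda>\<omega>. Y \<omega> \<bullet> (?K *v Y \<omega>)) = integral\<^sup>L M (\<lambda>\<omega>. (T *v X \<omega>) \<bullet> (?K *v (T *v X \<omega>)))"
    using Y TX by (rule has_second_moment_quadratic_cong)
  also have "\<dots> = integral\<^sup>L M (\<lambda>\<omega>. X \<omega> \<bullet> (T *v X \<omega>))"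
    using T(2) by (simp add: matrix_inv_vector_mult inner_commute)
  finally have eq: "integral\<^sup>L M (\<lambda>\<omega>. Y \<omega> \<bullet> (?K *v Y \<omega>)) = \<dots>" .
  have "0 \<le> integral\<^sup>L M (\<lambda>\<omega>. (T *v X \<omega> - Y \<omega>) \<bullet> (?K *v (T *v X \<omega> - Y \<omega>)))"
    using nonneg by simp
  then show ?thesis
    unfolding inverse_quadratic_expand[OF sym T(2)] by (simp add: eq)
qed

lemma monge_map_stability:
  fixes B T :: "real^'n^'n"
  assumes X: "has_second_moment M X C" and Y: "has_second_moment M Y D"
    and TX: "has_second_moment M (\<lambda>\<omega>. T *v X \<omega>) D"
    and T: "psd_mat T" "invertible T"
    and B: "sym_mat B" and c: "0 < c" "c < 1"
    and near: "\<And>v. norm (B *v v - v) \<le> c * norm v"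
  shows "integral\<^sup>L M (\<lambda>\<omega>. (norm (T *v X \<omega> - B *v X \<omega>))\<^sup>2) \<le>
    (1 + c) / (1 - c) * integral\<^sup>L M (\<lambda>\<omega>. (norm (B *v X \<omega> - Y \<omega>))\<^sup>2)"
proof -
  note bounds = near_identity_inverse_bounds[OF c near]
  let ?K = "matrix_inv B"
  define gap where "gap x y = (B *v x - y) \<bullet> (?K *v (B *v x - y))" for x y
  have gap: "gap x y = x \<bullet> (B *v x) - 2 * (x \<bullet> y) + y \<bullet> (?K *v y)" for x y
    unfolding gap_def by (rule inverse_quadratic_expand[OF B bounds(1)])
  have BX: "has_second_moment M (\<lambda>\<omega>. B *v X \<omega>) (B ** C ** transpose B)"
    using X by (rule has_second_moment_linear)
  have intX [simp]: "integrable M (\<lambda>\<omega>. X \<omega> \<bullet> (B *v X \<omega>))"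
    by (rule has_second_moment_integrable_quadratic[OF X])
  \<comment> \<open>Stated for a generic \<open>Z\<close> because it is applied both to
    \<open>Y\<close> and to \<open>T *v X\<close>.\<close>
  have int: "integrable M (\<lambda>\<omega>. X \<omega> \<bullet> Z \<omega>)" "integrable M (\<lambda>\<omega>. Z \<omega> \<bullet> (?K *v Z \<omega>))"
    "integrable M (\<lambda>\<omega>. gap (X \<omega>) (Z \<omega>))" "integrable M (\<lambda>\<omega>. (norm (B *v X \<omega> - Z \<omega>))\<^sup>2)"
    if Z: "has_second_moment M Z D" for Z
  proof -
    show 1: "integrable M (\<lambda>\<omega>. X \<omega> \<bullet> Z \<omega>)" by (rule has_second_moment_integrable_cross[OF X Z])
    show 2: "integrable M (\<lambda>\<omega>. Z \<omega> \<bullet> (?K *v Z \<omega>))"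
      by (rule has_second_moment_integrable_quadratic[OF Z])
    show "integrable M (\<lambda>\<omega>. gap (X \<omega>) (Z \<omega>))" using 1 2 by (simp add: gap)
    have "(norm (B *v X \<omega> - Z \<omega>))\<^sup>2 =
        (norm (B *v X \<omega>))\<^sup>2 - 2 * ((B *v X \<omega>) \<bullet> Z \<omega>) + (norm (Z \<omega>))\<^sup>2" for \<omega>
      by (simp add: power2_norm_eq_inner inner_diff_left inner_diff_right inner_commute)
    then show "integrable M (\<lambda>\<omega>. (norm (B *v X \<omega> - Z \<omega>))\<^sup>2)"
      using has_second_moment_integrable_norm_square[OF BX] has_second_moment_integrable_norm_square[OF Z]
        has_second_moment_integrable_cross[OF BX Z] by simp
  qed
  \<comment> \<open>The outer terms of the two mean gaps agree, since \<open>Y\<close> and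
    \<open>T *v X\<close> share the second moment \<open>D\<close>. The gaps differ by twice the
    difference of the correlations with \<open>X\<close>.\<close>
  have "integral\<^sup>L M (\<lambda>\<omega>. gap (X \<omega>) (T *v X \<omega>)) \<le> integral\<^sup>L M (\<lambda>\<omega>. gap (X \<omega>) (Y \<omega>))"
    using psd_mat_maximises_correlation[OF X Y TX T] has_second_moment_quadratic_cong[OF Y TX, of ?K]
    by (simp add: gap int(1,2)[OF Y] int(1,2)[OF TX])
  moreover have "integral\<^sup>L M (\<lambda>\<omega>. (norm (B *v X \<omega> - T *v X \<omega>))\<^sup>2) \<le>
      integral\<^sup>L M (\<lambda>\<omega>. (1 + c) * gap (X \<omega>) (T *v X \<omega>))"
    using int[OF TX] bounds(2) by (intro integral_mono) (auto simp: gap_def)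
  moreover have "integral\<^sup>L M (\<lambda>\<omega>. (1 - c) * gap (X \<omega>) (Y \<omega>)) \<le>
      integral\<^sup>L M (\<lambda>\<omega>. (norm (B *v X \<omega> - Y \<omega>))\<^sup>2)"
    using int[OF Y] bounds(3) by (intro integral_mono) (auto simp: gap_def)
  \<comment> \<open>The rest is arithmetic: \<open>r \<le> (1 + c) * p \<le> (1 + c) * q \<le> (1 +
    c) / (1 - c) * s\<close>.\<close>
  moreover define p q r s where "p = integral\<^sup>L M (\<lambda>\<omega>. gap (X \<omega>) (T *v X \<omega>))"
    and "q = integral\<^sup>L M (\<lambda>\<omega>. gap (X \<omega>) (Y \<omega>))"
    and "r = integral\<^sup>L M (\<lambda>\<omega>. (norm (B *v X \<omega> - T *v X \<omega>))\<^sup>2)"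
    and "s = integral\<^sup>L M (\<lambda>\<omega>. (norm (B *v X \<omega> - Y \<omega>))\<^sup>2)"
  ultimately have pq: "p \<le> q" and r: "r \<le> (1 + c) * p" and q: "(1 - c) * q \<le> s"
    by simp_all
  have "r \<le> (1 + c) * q" using pq r c by (smt (verit) mult_left_mono)
  also have "q \<le> s / (1 - c)" using q c by (simp add: pos_le_divide_eq mult.commute)
  then have "(1 + c) * q \<le> (1 + c) * (s / (1 - c))" using c by (intro mult_left_mono) auto
  finally have "r \<le> (1 + c) / (1 - c) * s" by simp
  then show ?thesis by (simp add: r_def s_def norm_minus_commute)
qed

lemma has_second_moment_monge_mat:
  fixes S1 S2 :: "real^'n^'n"
  assumes "has_second_moment M X S1" "pd_mat S1" "pd_mat S2"
  shows "has_second_moment M (\<lambda>\<omega>. monge_mat S1 S2 *v X \<omega>) S2"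
  using has_second_moment_linear[OF assms(1), of "monge_mat S1 S2"] monge_mat_properties[OF assms(2,3)]
  by (simp add: psd_mat_def sym_mat_def)

section \<open>Application to the Gaussian curve\<close>

theorem theorem3:
  fixes P :: "'a measure"
    and Sigma V :: "real \<Rightarrow> real^'n^'n"
    and X :: "real \<Rightarrow> 'a \<Rightarrow> real^'n"
    and Tb :: "real^'n^'n"
    and t h c L :: real
  assumes P: "prob_space P"
    and pd: "\<And>s. s \<in> {0..1} \<Longrightarrow> pd_mat (Sigma s)"
    and Vsym: "\<And>s. s \<in> {0..1} \<Longrightarrow> sym_mat (V s)"
    and Vcont: "continuous_on {0..1} V"
    and Xmeas: "\<And>s. s \<in> {0..1} \<Longrightarrow> X s \<in> borel_measurable P"
    and Xlaw: "\<And>s. s \<in> {0..1} \<Longrightarrow> distr P borel (X s) = gaussian (Sigma s)"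
    and Xode: "\<And>\<omega> s. \<omega> \<in> space P \<Longrightarrow> s \<in> {0..1} \<Longrightarrow>
                 ((\<lambda>r. X r \<omega>) has_vector_derivative (V s *v X s \<omega>)) (at s within {0..1})"
    and Lbdd: "bdd_above ((\<lambda>s. L2norm P (\<lambda>\<omega>. V s *v X s \<omega>)) ` {0..1})"
    and Ldef: "L = (SUP s\<in>{0..1}. L2norm P (\<lambda>\<omega>. V s *v X s \<omega>))"
    and t: "t \<in> {0..1}" and th: "t + h \<in> {0..1}" and h: "h \<noteq> 0"
    and c: "0 < c" "c < 1"
    and delta: "\<bar>h\<bar> * L \<le> c * sqrt (lambda_min (Sigma t))"
    and Tbsym: "sym_mat Tb"
    and Tbclose: "L2norm P (\<lambda>\<omega>. Tb *v X t \<omega> - X t \<omega>) \<le> c * sqrt (lambda_min (Sigma t))"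
  shows "L2norm P (\<lambda>\<omega>. monge_mat (Sigma t) (Sigma (t + h)) *v X t \<omega> - Tb *v X t \<omega>)
         \<le> (1 + 2 * c) / (1 - c) * L2norm P (\<lambda>\<omega>. Tb *v X t \<omega> - X (t + h) \<omega>)"
proof -
  \<comment> \<open>The law of each \<open>X s\<close> is converted into its covariance, the form in
    which the stability estimate takes it.\<close>
  have moment: "has_second_moment P (X s) (Sigma s)" if "s \<in> {0..1}" for s
    using has_second_moment_gaussian[OF pd_mat_imp_psd_mat[OF pd[OF that]]] Xmeas[OF that]
    by (simp add: Xlaw[OF that, symmetric] has_second_moment_distr)
  have I: "(Tb - mat 1) *v v = Tb *v v - v" for v
    by (simp add: matrix_vector_mult_diff_rdistrib)
  \<comment> \<open>The displacement \<open>Tb - mat 1\<close> is the symmetric matrix whose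
    mean-square bound \<open>Tbclose\<close> becomes an operator norm bound by
    \<open>c\<close>.\<close>
  have "sym_mat (Tb - mat 1)"
    using Tbsym by (intro sym_matI) (simp add: I sym_mat_inner inner_diff_left inner_diff_right)
  then have near: "norm (Tb *v v - v) \<le> c * norm v" for v
    using L2norm_linear_le_imp_norm_le[OF moment[OF t] pd[OF t], of c "Tb - mat 1" v] c Tbclose
    by (simp add: I)
  let ?T = "monge_mat (Sigma t) (Sigma (t + h))"
  let ?q = "(1 + c) / (1 - c)"
  have "integral\<^sup>L P (\<lambda>\<omega>. (norm (?T *v X t \<omega> - Tb *v X t \<omega>))\<^sup>2) \<le>
      ?q * integral\<^sup>L P (\<lambda>\<omega>. (norm (Tb *v X t \<omega> - X (t + h) \<omega>))\<^sup>2)"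
    using monge_mat_properties[OF pd[OF t] pd[OF th]]
    by (intro monge_map_stability[OF moment[OF t] moment[OF th]]
        has_second_moment_monge_mat[OF moment[OF t] pd[OF t] pd[OF th]] Tbsym c near)
  then have "L2norm P (\<lambda>\<omega>. ?T *v X t \<omega> - Tb *v X t \<omega>) \<le>
      sqrt ?q * L2norm P (\<lambda>\<omega>. Tb *v X t \<omega> - X (t + h) \<omega>)"
    unfolding L2norm_def real_sqrt_mult[symmetric] by (rule real_sqrt_le_mono)
  \<comment> \<open>Since \<open>?q\<close> is at least 1, it dominates its own square root, and
    enlarging its numerator to \<open>1 + 2 * c\<close> gives the claimed constant.\<close>
  moreover have "1 \<le> ?q" using c by simp
  then have "sqrt ?q \<le> ?q" by (intro real_le_lsqrt self_le_power) simp_all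
  then have "sqrt ?q \<le> (1 + 2 * c) / (1 - c)"
    using c divide_right_mono[of "1 + c" "1 + 2 * c" "1 - c"] by linarith
  then have "sqrt ?q * L2norm P (\<lambda>\<omega>. Tb *v X t \<omega> - X (t + h) \<omega>) \<le>
      (1 + 2 * c) / (1 - c) * L2norm P (\<lambda>\<omega>. Tb *v X t \<omega> - X (t + h) \<omega>)"
    by (rule mult_right_mono) (simp add: L2norm_def)
  ultimately show ?thesis by (rule order_trans)
qed

end
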